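(* Let $q\equiv1\pmod 4$ be a prime power and let $i\in\mathbb{F}_q$ be a primitive $4$th root of unity, so that $\{(t,it):t\in\mathbb{F}_q\}$ and $\{(t,-it):t\in\mathbb{F}_q\}$ are the two isotropic lines in $\mathbb{F}_q^2$. For any nonzero $c\in\mathbb{F}_q$, $$q\le P(q,c)\le q+1.$$ Moreover, the $q$ circles of radius $c$ centered at the $q$ points of an isotropic line are pairwise disjoint, and the complement in $\mathbb{F}_q^2$ of their union is exactly that isotropic line.
   Context: For $v=(v_1,v_2)\in\mathbb{F}_q^2$, $\|v\|=v_1^2+v_2^2$. The circle of radius $R$ and center $(u,v)$ is $C_R((u,v))=\{(x,y)\in\mathbb{F}_q^2:(x-u)^2+(y-v)^2=R\}$. The packing number $P(q,c)$ is the maximum number of pairwise disjoint circles of radius $c$ in $\mathbb{F}_q^2$. A line is isotropic if $\|v\|=0$ for all $v$ on it. *)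

theory Defs
  imports "HOL-Library.Cardinality" "HOL-Number_Theory.Cong"
begin

definition primitive_root_of_unity :: "nat \<Rightarrow> 'a::field \<Rightarrow> bool" where
  "primitive_root_of_unity n x \<longleftrightarrow> 0 < n \<and> x ^ n = 1 \<and> (\<forall>k. 0 < k \<and> k < n \<longrightarrow> x ^ k \<noteq> 1)"

definition qnorm :: "'a::field \<times> 'a \<Rightarrow> 'a" where
  "qnorm v = (fst v)\<^sup>2 + (snd v)\<^sup>2"

definition circle :: "'a::field \<Rightarrow> 'a \<times> 'a \<Rightarrow> ('a \<times> 'a) set" where
  "circle R u = {p. (fst p - fst u)\<^sup>2 + (snd p - snd u)\<^sup>2 = R}"

definition packing_number :: "'a::{field,finite} \<Rightarrow> nat" where
  "packing_number c = Max {card F | F. F \<subseteq> range (circle c) \<and> pairwise disjnt F}"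

text \<open>Lines are affine lines, not necessarily through the origin.\<close>

definition is_line :: "('a::field \<times> 'a) set \<Rightarrow> bool" where
  "is_line L \<longleftrightarrow> (\<exists>a b d e. (d, e) \<noteq> (0, 0) \<and> L = {(a + t * d, b + t * e) | t. True})"

definition isotropic_line :: "('a::field \<times> 'a) set \<Rightarrow> bool" where
  "isotropic_line L \<longleftrightarrow> is_line L \<and> (\<forall>v\<in>L. qnorm v = 0)"

end

theory Submission imports Defs begin

text \<open>
  If \<open>j\<^sup>2 = -1\<close> then \<open>x\<^sup>2 + y\<^sup>2 = (x + j y) (x - j y)\<close>. On an isotropic line the first factor
  vanishes, so the circle of radius \<open>c\<close> around a point \<open>u\<close> of that line is the hyperbola
  \<open>(x + j y) ((x - j y) - (u\<^sub>1 - j u\<^sub>2)) = c\<close>. A point with \<open>x + j y \<noteq> 0\<close> determines \<open>u\<close>, hence lies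
  on exactly one of these circles, and a point with \<open>x + j y = 0\<close> lies on none. Since all circles of
  radius \<open>c\<close> are translates of one another, this partition of \<open>q\<^sup>2 - q\<close> points into \<open>q\<close> circles also
  shows that each has \<open>q - 1\<close> points, and \<open>(q + 2) (q - 1) > q\<^sup>2\<close> bounds every packing.
\<close>

section \<open>Isotropic lines through a square root of -1\<close>

text \<open>The slope is a parameter so that both isotropic lines, \<open>j = i\<close> and
  \<open>j = - i\<close>, are handled by the same lemmas, which ask only for
  \<open>j\<^sup>2 = -1\<close>.\<close>

definition diag_line :: "'a::field \<Rightarrow> ('a \<times> 'a) set" where
  "diag_line j = {(t, j * t) | t. True}"

text \<open>Primitivity rules out the first factor of
  \<open>i ^ 4 - 1 = (i\<^sup>2 - 1) * (i\<^sup>2 + 1)\<close>. In characteristic 2 the two factors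
  would coincide.\<close>

lemma primitive_4th_root_square:
  fixes i :: "'a::field"
  assumes "primitive_root_of_unity 4 i"
  shows "i\<^sup>2 = -1" and "(2::'a) \<noteq> 0"
proof -
  have i4: "i ^ 4 = 1" and i2: "i\<^sup>2 \<noteq> 1"
    using assms by (auto simp: primitive_root_of_unity_def)
  have "(i\<^sup>2 - 1) * (i\<^sup>2 + 1) = i ^ 4 - 1"
    by (simp add: algebra_simps flip: power_add)
  then have "i\<^sup>2 + 1 = 0"
    using i4 i2 by simp
  then show sq: "i\<^sup>2 = -1"
    by (simp add: eq_neg_iff_add_eq_0)
  show "(2::'a) \<noteq> 0"
  proof
    assume "(2::'a) = 0"
    then have "(1::'a) + 1 = 0" by simp
    then have "(-1::'a) = 1" by (simp add: neg_eq_iff_add_eq_0)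
    then show False using sq i2 by simp
  qed
qed

lemma diag_line_iff:
  fixes j :: "'a::field"
  assumes "j\<^sup>2 = -1"
  shows "p \<in> diag_line j \<longleftrightarrow> fst p + j * snd p = 0"
proof -
  have "snd p = j * fst p \<longleftrightarrow> fst p + j * snd p = 0"
    using assms by algebra
  then show ?thesis
    by (cases p) (auto simp: diag_line_def)
qed

lemma diag_line_inject:
  fixes j k :: "'a::field"
  assumes "diag_line j = diag_line k"
  shows "j = k"
proof -
  have "(1, j) \<in> diag_line j" by (force simp: diag_line_def)
  then have "(1, j) \<in> diag_line k" using assms by simp
  then show ?thesis by (simp add: diag_line_def)
qed

lemma card_diag_line: "card (diag_line (j :: 'a::{field,finite})) = CARD('a)"
proof -
  have "diag_line j = range (\<lambda>t. (t, j * t))" by (auto simp: diag_line_def)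
  then show ?thesis by (simp add: card_image inj_on_def)
qed

lemma isotropic_diag_line:
  fixes j :: "'a::field"
  assumes "j\<^sup>2 = -1"
  shows "isotropic_line (diag_line j)"
proof -
  have "is_line (diag_line j)"
    unfolding is_line_def diag_line_def
    by (rule exI[of _ 0], rule exI[of _ 0], rule exI[of _ 1], rule exI[of _ j])
       (auto simp: mult.commute)
  then show ?thesis
    using assms by (auto simp: isotropic_line_def diag_line_def qnorm_def power_mult_distrib)
qed

text \<open>Along an affine line \<open>qnorm\<close> is a quadratic polynomial in the parameter.
  Its values at 0, 1 and -1 determine all coefficients when 2 is invertible, so base point and
  direction are isotropic and mutually orthogonal.\<close>

lemma isotropic_line_cases:
  fixes i :: "'a::field"
  assumes i: "i\<^sup>2 = -1" and two: "(2::'a) \<noteq> 0" and L: "isotropic_line L"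
  obtains "L = diag_line i" | "L = diag_line (- i)"
proof -
  from L obtain a b d e where de: "(d, e) \<noteq> (0, 0)"
    and Leq: "L = {(a + t * d, b + t * e) | t. True}"
    and iso: "\<forall>v\<in>L. qnorm v = 0"
    by (auto simp: isotropic_line_def is_line_def)
  have q: "(a + t * d)\<^sup>2 + (b + t * e)\<^sup>2 = 0" for t
    using iso unfolding Leq qnorm_def by force
  have q0: "a\<^sup>2 + b\<^sup>2 = 0" using q[of 0] by simp
  have q1: "(d\<^sup>2 + e\<^sup>2) + 2 * (a * d + b * e) = 0"
    using q[of 1] q0 by (simp, algebra)
  have q2: "(d\<^sup>2 + e\<^sup>2) - 2 * (a * d + b * e) = 0"
    using q[of "-1"] q0 by (simp, algebra)
  have "2 * (d\<^sup>2 + e\<^sup>2) = 0" "2 * (2 * (a * d + b * e)) = 0"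
    using q1 q2 by algebra+
  then have dd: "d\<^sup>2 + e\<^sup>2 = 0" and ad: "a * d + b * e = 0"
    using two by (simp_all only: mult_eq_0_iff simp_thms)
  have "(e - i * d) * (e + i * d) = 0"
    using dd i by algebra
  then have "e = i * d \<or> e = - i * d"
    by (simp add: eq_neg_iff_add_eq_0)
  then obtain j where j: "j = i \<or> j = - i" and e: "e = j * d"
    by blast
  have jsq: "j\<^sup>2 = -1" using j i by auto
  have d: "d \<noteq> 0" using de e by auto
  \<comment> \<open>A vector orthogonal to an isotropic direction is a multiple of it; hence the
    line passes through the origin.\<close>
  have "d * (a + j * b) = 0" using ad e by algebra
  then have "a + j * b = 0" using d by simp
  then have b: "b = j * a" using jsq by algebra
  have "L = diag_line j"
  proof (intro set_eqI iffI)
    fix p assume "p \<in> L"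
    then show "p \<in> diag_line j"
      by (auto simp: Leq diag_line_def b e algebra_simps)
  next
    fix p assume "p \<in> diag_line j"
    then obtain s where p: "p = (s, j * s)" by (auto simp: diag_line_def)
    define t where "t = (s - a) / d"
    have "s = a + t * d" using d by (simp add: t_def)
    then have "p = (a + t * d, b + t * e)"
      by (simp add: p b e algebra_simps)
    then show "p \<in> L" unfolding Leq by blast
  qed
  with j that show thesis by blast
qed

section \<open>Circles centered on an isotropic line\<close>

text \<open>The term \<open>2 * fst u\<close> is \<open>fst u - j * snd u\<close>, since
  \<open>snd u = j * fst u\<close> and \<open>j\<^sup>2 = -1\<close>.\<close>

lemma mem_circle_diag_line_iff:
  fixes j :: "'a::field"
  assumes j: "j\<^sup>2 = -1" and u: "u \<in> diag_line j"
  shows "p \<in> circle c u \<longleftrightarrow> (fst p + j * snd p) * ((fst p - j * snd p) - 2 * fst u) = c"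
proof -
  have factor: "(x - t)\<^sup>2 + (y - j * t)\<^sup>2 = (x + j * y) * ((x - j * y) - 2 * t)" for x y t
    using j by algebra
  from u obtain t where "u = (t, j * t)" by (auto simp: diag_line_def)
  then have "(fst p - fst u)\<^sup>2 + (snd p - snd u)\<^sup>2
      = (fst p + j * snd p) * ((fst p - j * snd p) - 2 * fst u)"
    by (simp only: fst_conv snd_conv factor)
  then show ?thesis by (simp add: circle_def)
qed

text \<open>At a common point the nonzero first factor cancels. Quantifying over distinct centers
  rather than distinct circles lets this also serve for injectivity of
  \<open>circle c\<close>.\<close>

lemma disjoint_circles_diag_line:
  fixes j :: "'a::field"
  assumes j: "j\<^sup>2 = -1" and two: "(2::'a) \<noteq> 0" and c: "c \<noteq> 0"
  shows "pairwise (\<lambda>u v. disjnt (circle c u) (circle c v)) (diag_line j)"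
proof (rule pairwiseI)
  fix u v assume u: "u \<in> diag_line j" and v: "v \<in> diag_line j" and "u \<noteq> v"
  have "u = v" if "p \<in> circle c u" "p \<in> circle c v" for p
  proof -
    let ?s = "fst p + j * snd p" and ?r = "fst p - j * snd p"
    have 1: "?s * (?r - 2 * fst u) = c" and 2: "?s * (?r - 2 * fst v) = c"
      using that mem_circle_diag_line_iff[OF j] u v by blast+
    have "?s \<noteq> 0" using 1 c by auto
    moreover have "?s * (?r - 2 * fst u) = ?s * (?r - 2 * fst v)" using 1 2 by simp
    ultimately have "fst u = fst v" using two by simp
    then show ?thesis using u v by (auto simp: diag_line_def)
  qed
  with \<open>u \<noteq> v\<close> show "disjnt (circle c u) (circle c v)"
    by (auto simp: disjnt_def)
qed

lemma Compl_Union_circles_diag_line: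
  fixes j :: "'a::field"
  assumes j: "j\<^sup>2 = -1" and two: "(2::'a) \<noteq> 0" and c: "c \<noteq> 0"
  shows "- (\<Union>u\<in>diag_line j. circle c u) = diag_line j"
proof -
  have "(\<exists>u\<in>diag_line j. p \<in> circle c u) \<longleftrightarrow> fst p + j * snd p \<noteq> 0" for p
  proof
    assume "\<exists>u\<in>diag_line j. p \<in> circle c u"
    then obtain u where u: "u \<in> diag_line j" "p \<in> circle c u" by blast
    have "(fst p + j * snd p) * ((fst p - j * snd p) - 2 * fst u) = c"
      using mem_circle_diag_line_iff[OF j u(1)] u(2) by simp
    then show "fst p + j * snd p \<noteq> 0"
      using c by auto
  next
    let ?s = "fst p + j * snd p" and ?r = "fst p - j * snd p"
    assume s: "?s \<noteq> 0"
    \<comment> \<open>This solves the hyperbola equation at \<open>p\<close> for the center.\<close>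
    define t where "t = (?r - c / ?s) / 2"
    have "2 * t = ?r - c / ?s" unfolding t_def
      using two by (simp only: times_divide_eq_right nonzero_mult_div_cancel_left not_False_eq_True)
    then have "?s * (?r - 2 * t) = c" using s by simp
    moreover have m: "(t, j * t) \<in> diag_line j" by (auto simp: diag_line_def)
    ultimately have "p \<in> circle c (t, j * t)"
      using mem_circle_diag_line_iff[OF j m] by simp
    with m show "\<exists>u\<in>diag_line j. p \<in> circle c u" by blast
  qed
  then show ?thesis
    by (intro set_eqI) (simp only: Compl_iff UN_iff diag_line_iff[OF j] simp_thms)
qed

section \<open>Counting points and packings\<close>

lemma card_circle_translate:
  "card (circle c u) = card (circle (c :: 'a::{field,finite}) v)"
proof (rule bij_betw_same_card)
  show "bij_betw (\<lambda>p. (fst p - fst u + fst v, snd p - snd u + snd v)) (circle c u) (circle c v)"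
    by (rule bij_betw_byWitness
        [where f' = "\<lambda>p. (fst p - fst v + fst u, snd p - snd v + snd u)"])
      (auto simp: circle_def)
qed

text \<open>The line and the equally large circles centered on it partition the plane, so
  \<open>q * (card (circle c u) + 1) = q * q\<close> with \<open>q = CARD('a)\<close>.\<close>

lemma card_circle:
  fixes j c :: "'a::{field,finite}"
  assumes j: "j\<^sup>2 = -1" and two: "(2::'a) \<noteq> 0" and c: "c \<noteq> 0"
  shows "card (circle c u) + 1 = CARD('a)"
proof -
  let ?U = "\<Union>v\<in>diag_line j. circle c v"
  have "card ?U = (\<Sum>v\<in>diag_line j. card (circle c v))"
    using disjoint_circles_diag_line[OF j two c]
    by (intro card_UN_disjoint) (auto simp: pairwise_def disjnt_def)
  also have "\<dots> = (\<Sum>v\<in>diag_line j. card (circle c u))"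
    by (rule sum.cong[OF refl card_circle_translate])
  also have "\<dots> = CARD('a) * card (circle c u)"
    by (simp add: card_diag_line)
  finally have "card ?U = CARD('a) * card (circle c u)" .
  moreover have "card ?U + card (- ?U) = CARD('a \<times> 'a)"
    by (subst card_Un_disjoint[symmetric]) (simp_all only: finite Compl_disjoint Compl_partition)
  ultimately have "CARD('a) * (card (circle c u) + 1) = CARD('a) * CARD('a)"
    unfolding Compl_Union_circles_diag_line[OF j two c] by (simp add: card_diag_line)
  then show ?thesis by (subst (asm) mult_cancel1) simp
qed

lemma card_circles_diag_line:
  fixes j c :: "'a::{field,finite}"
  assumes j: "j\<^sup>2 = -1" and two: "(2::'a) \<noteq> 0" and c: "c \<noteq> 0" and q: "2 \<le> CARD('a)"
  shows "card (circle c ` diag_line j) = CARD('a)"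
proof -
  \<comment> \<open>Two empty circles would be disjoint and yet equal, so disjointness alone does
    not separate them.\<close>
  have ne: "circle c v \<noteq> {}" for v
    using card_circle[OF j two c, of v] q by auto
  have "inj_on (circle c) (diag_line j)"
    using disjoint_circles_diag_line[OF j two c] ne
    by (intro inj_onI) (metis pairwiseD disjnt_self_iff_empty)
  then show ?thesis by (simp add: card_image card_diag_line)
qed

lemma card_circle_packing_le:
  fixes j c :: "'a::{field,finite}"
  assumes j: "j\<^sup>2 = -1" and two: "(2::'a) \<noteq> 0" and c: "c \<noteq> 0" and q: "3 \<le> CARD('a)"
    and F: "F \<subseteq> range (circle c)" "pairwise disjnt F"
  shows "card F \<le> CARD('a) + 1"
proof -
  define k where "k = CARD('a) - 1"
  have k: "CARD('a) = k + 1" and k2: "2 \<le> k"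
    using q by (simp_all add: k_def)
  have cF: "card A = k" if "A \<in> F" for A
    using that F(1) card_circle[OF j two c] k by fastforce
  have "card F * k = (\<Sum>A\<in>F. card A)" using cF by simp
  also have "\<dots> = card (\<Union>F)"
    using F(2) by (intro card_Union_disjoint[symmetric]) auto
  also have "\<dots> \<le> CARD('a \<times> 'a)" by (rule card_mono) auto
  also have "\<dots> = (k + 1) * (k + 1)" by (simp add: k)
  finally have le: "card F * k \<le> (k + 1) * (k + 1)" .
  show ?thesis
  proof (rule ccontr)
    assume "\<not> ?thesis"
    \<comment> \<open>A larger packing has at least \<open>q + 2 = k + 3\<close> circles of
      \<open>k\<close> points each, and \<open>k * k + 3 * k\<close> exceeds
      \<open>k * k + 2 * k + 1\<close> once \<open>k\<close> is at least 2.\<close>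
    then have "(k + 3) * k \<le> card F * k" by (intro mult_right_mono) (auto simp: k)
    then have "(k + 3) * k \<le> (k + 1) * (k + 1)" using le by linarith
    then show False using k2 by (simp add: algebra_simps)
  qed
qed

theorem mainTheorem10:
  fixes i c :: "'a::{field,finite}"
  assumes "[CARD('a) = 1] (mod 4)"
    and "primitive_root_of_unity 4 i"
    and "c \<noteq> 0"
  shows "{(t, i * t) | t. True} \<noteq> {(t, - i * t) | t. True} \<and>
    {L. isotropic_line L} = {{(t, i * t) | t. True}, {(t, - i * t) | t. True}} \<and>
    CARD('a) \<le> packing_number c \<and> packing_number c \<le> CARD('a) + 1 \<and>
    (\<forall>L. isotropic_line L \<longrightarrow>
      card L = CARD('a) \<and>
      card (circle c ` L) = CARD('a) \<and>
      pairwise (\<lambda>u v. disjnt (circle c u) (circle c v)) L \<and>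
      - (\<Union>u\<in>L. circle c u) = L)"
proof -
  note i = primitive_4th_root_square(1)[OF assms(2)]
  note two = primitive_4th_root_square(2)[OF assms(2)]
  have i': "(- i)\<^sup>2 = -1" using i by simp
  have i0: "i \<noteq> 0" using i by auto
  have "i \<noteq> - i"
  proof
    assume "i = - i"
    then have "2 * i = 0" by (metis eq_neg_iff_add_eq_0 mult_2)
    then show False using two i0 by simp
  qed
  then have ne: "diag_line i \<noteq> diag_line (- i)"
    using diag_line_inject by blast
  have "card {0, 1, -1 :: 'a} = 3"
    using two by (auto simp: eq_neg_iff_add_eq_0)
  then have q3: "3 \<le> CARD('a)"
    by (metis card_mono finite subset_UNIV)
  have lines: "{L. isotropic_line L} = {diag_line i, diag_line (- i)}"
    using isotropic_line_cases[OF i two] isotropic_diag_line[OF i] isotropic_diag_line[OF i']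
    by blast
  have diag: "card (diag_line j) = CARD('a) \<and> card (circle c ` diag_line j) = CARD('a) \<and>
      pairwise (\<lambda>u v. disjnt (circle c u) (circle c v)) (diag_line j) \<and>
      - (\<Union>u\<in>diag_line j. circle c u) = diag_line j" if "j\<^sup>2 = -1" for j
    using card_diag_line[of j] card_circles_diag_line[OF that two assms(3)] q3
      disjoint_circles_diag_line[OF that two assms(3)]
      Compl_Union_circles_diag_line[OF that two assms(3)] by simp
  let ?P = "{card F | F. F \<subseteq> range (circle c) \<and> pairwise disjnt F}"
  have fin: "finite ?P" by simp
  have "pairwise disjnt (circle c ` diag_line i)"
    using diag[OF i] by (auto simp: pairwise_def)
  \<comment> \<open>Besides the lower bound, this gives the nonemptiness of \<open>?P\<close> needed
    to bound its \<open>Max\<close> from above.\<close>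
  then have mem: "CARD('a) \<in> ?P"
    using diag[OF i] by (auto intro!: exI[of _ "circle c ` diag_line i"])
  have "CARD('a) \<le> packing_number c"
    unfolding packing_number_def by (rule Max_ge[OF fin mem])
  moreover have "packing_number c \<le> CARD('a) + 1"
    unfolding packing_number_def
    using Max_in[OF fin] mem card_circle_packing_le[OF i two assms(3) q3]
    by (intro Max.boundedI[OF fin]) auto
  moreover have "\<forall>L. isotropic_line L \<longrightarrow>
      card L = CARD('a) \<and> card (circle c ` L) = CARD('a) \<and>
      pairwise (\<lambda>u v. disjnt (circle c u) (circle c v)) L \<and>
      - (\<Union>u\<in>L. circle c u) = L"
  proof (intro allI impI)
    fix L :: "('a \<times> 'a) set" assume "isotropic_line L"
    then consider "L = diag_line i" | "L = diag_line (- i)"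
      by (rule isotropic_line_cases[OF i two])
    then show "card L = CARD('a) \<and> card (circle c ` L) = CARD('a) \<and>
      pairwise (\<lambda>u v. disjnt (circle c u) (circle c v)) L \<and>
      - (\<Union>u\<in>L. circle c u) = L"
      by cases (use diag[OF i] diag[OF i'] in \<open>simp_all only:\<close>)
  qed
  ultimately show ?thesis
    using ne lines unfolding diag_line_def by blast
qed

end
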